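(* Let $G$ and $H$ be two graphs on $n$ vertices with diameter $2$. Then $G$ and $H$ have the same $2$-neighborhood degree list if and only if $G$ can be transformed into $H$ by a sequence of degree restricted $2$-switches.
   Context: The graphs $G$ and $H$ are on the same vertex set. The degree $\deg(v)$ of a vertex $v$ is the number of edges incident to $v$. The distance $d(u,v)$ between vertices $u$ and $v$ is the length of a shortest path between them, and the diameter of a graph is the maximum of $d(u,v)$ over all pairs of vertices $u$ and $v$. For a vertex $v$, $N_2(v)$ is the set of vertices at distance $2$ from $v$, and the $2$-neighborhood degree list of $v$, denoted $N_2DL(v)$, is the list of degrees of the vertices in $N_2(v)$, written in descending order. The $2$-neighborhood degree list of a graph $G$ with vertices $v_1,\dots,v_n$, denoted $N_2DL(G)$, is the list of lists $\{N_2DL(v_1), N_2DL(v_2), \dots, N_2DL(v_n)\}$, that is, a listing of $N_2DL(v)$ for every vertex $v$. A $2$-switch in a graph is the replacement of a pair of edges $v_1v_2$ and $w_1w_2$ by the edges $v_1w_2$ and $v_2w_1$, given that $v_1w_2$ and $v_2w_1$ did not appear in the graph originally; there may or may not be edges between the pairs of vertices $v_1,w_1$ and $v_2,w_2$. A degree restricted $2$-switch on edges $v_1v_2$ and $w_1w_2$ is a $2$-switch performed when $\deg(v_1)=\deg(w_1)$ and $\deg(v_2)=\deg(w_2)$. *)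

theory Defs
  imports "Graph_Theory.Graph_Theory" "HOL-Library.Multiset"
begin

text \<open>
  Finite simple graphs are the \<^locale>\<open>pair_graph\<close>s of the library: the edge \<open>uv\<close> is the pair of
  opposite arcs \<open>(u, v)\<close> and \<open>(v, u)\<close>. Hence the number of edges incident to a vertex is its
  out-degree.
\<close>

definition vertex_degree :: "'a pair_pre_digraph \<Rightarrow> 'a \<Rightarrow> nat" where
  "vertex_degree G v = out_degree (with_proj G) v"

text \<open>Unit arc costs make the cost of a walk its length; the distance is \<open>\<infinity>\<close> if there is no walk.\<close>

definition distance :: "'a pair_pre_digraph \<Rightarrow> 'a \<Rightarrow> 'a \<Rightarrow> ereal" where
  "distance G u v = wf_digraph.\<mu> (with_proj G) (\<lambda>_. 1) u v"

definition graph_diameter :: "'a pair_pre_digraph \<Rightarrow> ereal" where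
  "graph_diameter G = (SUP (u, v) \<in> pverts G \<times> pverts G. distance G u v)"

definition N2 :: "'a pair_pre_digraph \<Rightarrow> 'a \<Rightarrow> 'a set" where
  "N2 G v = {u \<in> pverts G. distance G v u = 2}"

definition N2DL :: "'a pair_pre_digraph \<Rightarrow> 'a \<Rightarrow> nat list" where
  "N2DL G v = rev (sorted_list_of_multiset (image_mset (vertex_degree G) (mset_set (N2 G v))))"

text \<open>The list \<open>vs\<close> is the enumeration \<open>v\<^sub>1, \<dots>, v\<^sub>n\<close> of the vertices.\<close>

definition N2DL_graph :: "'a pair_pre_digraph \<Rightarrow> 'a list \<Rightarrow> nat list list" where
  "N2DL_graph G vs = map (N2DL G) vs"

definition two_switch ::
  "'a pair_pre_digraph \<Rightarrow> 'a \<Rightarrow> 'a \<Rightarrow> 'a \<Rightarrow> 'a \<Rightarrow> 'a pair_pre_digraph \<Rightarrow> bool" where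
  "two_switch G v1 v2 w1 w2 H \<longleftrightarrow>
     distinct [v1, v2, w1, w2] \<and>
     (v1, v2) \<in> parcs G \<and> (w1, w2) \<in> parcs G \<and>
     (v1, w2) \<notin> parcs G \<and> (v2, w1) \<notin> parcs G \<and>
     H = G\<lparr>parcs := (parcs G - {(v1, v2), (v2, v1), (w1, w2), (w2, w1)})
                     \<union> {(v1, w2), (w2, v1), (v2, w1), (w1, v2)}\<rparr>"

definition degree_restricted_two_switch ::
  "'a pair_pre_digraph \<Rightarrow> 'a pair_pre_digraph \<Rightarrow> bool" where
  "degree_restricted_two_switch G H \<longleftrightarrow>
     (\<exists>v1 v2 w1 w2. two_switch G v1 v2 w1 w2 H \<and>
        vertex_degree G v1 = vertex_degree G w1 \<and> vertex_degree G v2 = vertex_degree G w2)"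

end

theory Submission
  imports Defs
begin

text \<open>
  In a graph of diameter 2 the set \<open>N\<^sub>2(v)\<close> consists of the non-neighbours of \<open>v\<close>, so the
  2-neighborhood degree lists determine, and are determined by, the multisets of degrees of the
  neighbours of each vertex. Colour each vertex by its degree. A degree restricted 2-switch
  replaces neighbours by neighbours of the same colour. Conversely, let \<open>G\<close> and \<open>H\<close> have equal
  neighbour colour multisets; as switches are reversible, both graphs may be modified. If \<open>u\<close> is
  a neighbour of \<open>v\<close> in \<open>G\<close> only, there is \<open>w\<close> of the same colour that is a neighbour of \<open>v\<close> in
  \<open>H\<close> only. Compare the numbers of neighbours of colour \<open>c v\<close> that \<open>u\<close> and \<open>w\<close> have: if \<open>w\<close> has
  at least as many as \<open>u\<close>, some switch in \<open>G\<close> trades \<open>vu\<close> for \<open>vw\<close>; otherwise some switch in \<open>H\<close>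
  trades \<open>vw\<close> for \<open>vu\<close>. Once \<open>v\<close> has the same neighbours in both graphs, it is set aside and the
  argument continues with the remaining vertices.
\<close>

section \<open>Colour preserving switches\<close>

definition switch_arcs :: "'a rel \<Rightarrow> 'a \<Rightarrow> 'a \<Rightarrow> 'a \<Rightarrow> 'a \<Rightarrow> 'a rel" where
  "switch_arcs E a b x y =
     (E - {(a, b), (b, a), (x, y), (y, x)}) \<union> {(a, y), (y, a), (b, x), (x, b)}"

text \<open>The colouring is a parameter that stays fixed along a sequence of switches, whereas
  degrees refer to the current graph.\<close>

definition colour_switch :: "('a \<Rightarrow> 'c) \<Rightarrow> 'a rel \<Rightarrow> 'a rel \<Rightarrow> bool" where
  "colour_switch c E F \<longleftrightarrow>
     (\<exists>a b x y. distinct [a, b, x, y] \<and> (a, b) \<in> E \<and> (x, y) \<in> E \<and> (a, y) \<notin> E \<and> (b, x) \<notin> E \<and>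
        c a = c x \<and> c b = c y \<and> F = switch_arcs E a b x y)"

definition simple_arcs :: "'a rel \<Rightarrow> bool" where
  "simple_arcs E \<longleftrightarrow> sym E \<and> irrefl E \<and> finite E"

definition nbr_colours :: "('a \<Rightarrow> 'c) \<Rightarrow> 'a rel \<Rightarrow> 'a \<Rightarrow> 'c multiset" where
  "nbr_colours c E v = image_mset c (mset_set (E `` {v}))"

lemma simple_arcs_symD: "simple_arcs E \<Longrightarrow> (x, y) \<in> E \<Longrightarrow> (y, x) \<in> E"
  by (auto simp: simple_arcs_def sym_def)

lemma simple_arcs_irreflD: "simple_arcs E \<Longrightarrow> (x, x) \<notin> E"
  by (auto simp: simple_arcs_def irrefl_def)

lemma finite_nbrs: "simple_arcs E \<Longrightarrow> finite (E `` {v})"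
  by (simp add: simple_arcs_def finite_Image)

lemma count_nbr_colours:
  assumes "simple_arcs E"
  shows "count (nbr_colours c E v) k = card {x \<in> E `` {v}. c x = k}"
proof -
  have "c -` {k} \<inter> E `` {v} = {x \<in> E `` {v}. c x = k}" by auto
  then show ?thesis
    unfolding nbr_colours_def using finite_nbrs[OF assms]
    by (simp add: count_image_mset)
qed

lemma switch_arcs_nbrs:
  assumes "simple_arcs E" "distinct [a, b, x, y]"
  shows "switch_arcs E a b x y `` {z} =
    (if z = a then insert y (E `` {a} - {b})
     else if z = b then insert x (E `` {b} - {a})
     else if z = x then insert b (E `` {x} - {y})
     else if z = y then insert a (E `` {y} - {x})
     else E `` {z})"
  using assms(2) by (auto simp: switch_arcs_def)

lemma simple_arcs_switch:
  assumes "simple_arcs E" "distinct [a, b, x, y]"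
  shows "simple_arcs (switch_arcs E a b x y)"
  using assms by (auto simp: simple_arcs_def switch_arcs_def sym_def irrefl_def)

lemma image_mset_exchange:
  assumes "finite A" "b \<in> A" "y \<notin> A" "c b = c y"
  shows "image_mset c (mset_set (insert y (A - {b}))) = image_mset c (mset_set A)"
proof -
  have "mset_set A = add_mset b (mset_set (A - {b}))"
    using assms by (simp add: mset_set.remove)
  then show ?thesis using assms by simp
qed

lemma colour_switch_simple: "colour_switch c E F \<Longrightarrow> simple_arcs E \<Longrightarrow> simple_arcs F"
  unfolding colour_switch_def by (metis simple_arcs_switch)

text \<open>Each of the four vertices involved trades one neighbour for another of the same
  colour.\<close>

lemma colour_switch_nbr_colours:
  assumes "colour_switch c E F" "simple_arcs E"
  shows "nbr_colours c F z = nbr_colours c E z"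
proof -
  obtain a b x y where d: "distinct [a, b, x, y]" and ab: "(a, b) \<in> E" and xy: "(x, y) \<in> E"
    and ay: "(a, y) \<notin> E" and bx: "(b, x) \<notin> E" and c: "c a = c x" "c b = c y"
    and F: "F = switch_arcs E a b x y"
    using assms(1) unfolding colour_switch_def by blast
  have "(b, a) \<in> E" "(y, x) \<in> E" "(y, a) \<notin> E" "(x, b) \<notin> E"
    using ab xy ay bx simple_arcs_symD[OF assms(2)] by blast+
  then have swap:
      "image_mset c (mset_set (insert y (E `` {a} - {b}))) = image_mset c (mset_set (E `` {a}))"
      "image_mset c (mset_set (insert x (E `` {b} - {a}))) = image_mset c (mset_set (E `` {b}))"
      "image_mset c (mset_set (insert b (E `` {x} - {y}))) = image_mset c (mset_set (E `` {x}))"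
      "image_mset c (mset_set (insert a (E `` {y} - {x}))) = image_mset c (mset_set (E `` {y}))"
    using ab xy ay bx c finite_nbrs[OF assms(2)]
    by (simp_all only: image_mset_exchange Image_singleton_iff not_False_eq_True)
  show ?thesis
    unfolding nbr_colours_def F switch_arcs_nbrs[OF assms(2) d]
    by (simp only: swap split: if_split) blast
qed

text \<open>Switching the new edges \<open>ay\<close> and \<open>xb\<close> restores
  \<open>ab\<close> and \<open>xy\<close>, under the same colour conditions.\<close>

lemma colour_switch_sym:
  assumes "colour_switch c E F" "simple_arcs E"
  shows "colour_switch c F E"
proof -
  obtain a b x y where d: "distinct [a, b, x, y]" and ab: "(a, b) \<in> E" and xy: "(x, y) \<in> E"
    and ay: "(a, y) \<notin> E" and bx: "(b, x) \<notin> E" and c: "c a = c x" "c b = c y"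
    and F: "F = switch_arcs E a b x y"
    using assms(1) unfolding colour_switch_def by blast
  have E: "(b, a) \<in> E" "(y, x) \<in> E" "(y, a) \<notin> E" "(x, b) \<notin> E"
    using ab xy ay bx simple_arcs_symD[OF assms(2)] by blast+
  have "E = switch_arcs F a y x b"
    unfolding F switch_arcs_def using d E ab xy ay bx by auto
  moreover have "(a, y) \<in> F" "(x, b) \<in> F" "(a, b) \<notin> F" "(y, x) \<notin> F"
    unfolding F switch_arcs_def using d by auto
  ultimately show ?thesis
    unfolding colour_switch_def using d c
    by (intro exI[of _ a] exI[of _ y] exI[of _ x] exI[of _ b]) auto
qed

lemma colour_switches_invariants:
  assumes "(colour_switch c)\<^sup>*\<^sup>* E F" "simple_arcs E"
  shows "simple_arcs F \<and> (\<forall>z. nbr_colours c F z = nbr_colours c E z)"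
  using assms by induction (auto simp: colour_switch_simple colour_switch_nbr_colours)

lemma colour_switches_sym:
  assumes "(colour_switch c)\<^sup>*\<^sup>* E F" "simple_arcs E"
  shows "(colour_switch c)\<^sup>*\<^sup>* F E"
  using assms
proof induction
  case (step F F')
  then have "colour_switch c F' F"
    using colour_switches_invariants colour_switch_sym by metis
  then show ?case using step by (simp add: converse_rtranclp_into_rtranclp)
qed simp

section \<open>Connectedness under colour preserving switches\<close>

text \<open>Since \<open>v\<close> is adjacent to \<open>u\<close> but not to \<open>w\<close>, the
  inequality yields a neighbour \<open>x\<close> of \<open>w\<close>, coloured like
  \<open>v\<close>, that is not adjacent to \<open>u\<close>. The switch replaces \<open>vu\<close>,
  \<open>xw\<close> by \<open>vw\<close>, \<open>ux\<close>. Counting inside \<open>T\<close> puts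
  \<open>x\<close> in \<open>T\<close>, so vertices set aside are untouched.\<close>

lemma exchange_nbr:
  assumes E: "simple_arcs E" and T: "v \<in> T" "u \<in> T" "w \<in> T"
    and vu: "(v, u) \<in> E" and vw: "(v, w) \<notin> E" "v \<noteq> w" and c: "c u = c w"
    and le: "card {x \<in> E `` {u} \<inter> T. c x = c v} \<le> card {x \<in> E `` {w} \<inter> T. c x = c v}"
  obtains F where "colour_switch c E F" "F `` {v} = insert w (E `` {v} - {u})"
    "\<And>z. z \<notin> T \<Longrightarrow> F `` {z} = E `` {z}"
proof -
  note symD = simple_arcs_symD[OF E] and irr = simple_arcs_irreflD[OF E]
  define U where "U = {x \<in> E `` {u} \<inter> T. c x = c v}"
  define W where "W = {x \<in> E `` {w} \<inter> T. c x = c v}"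
  have fin: "finite U" "finite W"
    unfolding U_def W_def using finite_nbrs[OF E] by (simp_all del: Image_singleton_iff)
  \<comment> \<open>Either both or none of \<open>u \<in> W\<close> and \<open>w \<in> U\<close> hold, so removing them keeps the inequality.\<close>
  have "u \<in> W \<longleftrightarrow> w \<in> U"
    unfolding U_def W_def using T c symD by auto
  moreover have "card U \<le> card W" using le by (simp add: U_def W_def)
  ultimately have le': "card (U - {w}) \<le> card (W - {u})"
    using fin by (cases "u \<in> W") auto
  \<comment> \<open>An inclusion of \<open>W - {u}\<close> in \<open>U - {w}\<close> would be an
    equality by cardinality, but \<open>v\<close> lies in only one of them.\<close>
  have "v \<in> U - {w}" "v \<notin> W - {u}"
    unfolding U_def W_def using T vu vw symD by auto
  then have "\<not> W - {u} \<subseteq> U - {w}"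
    using le' fin by (metis card_seteq finite_Diff)
  then obtain x where x: "x \<in> W" "x \<noteq> u" "x \<notin> U - {w}" by blast
  have xw: "(x, w) \<in> E" and ux: "(u, x) \<notin> E" and xT: "x \<in> T" and cx: "c v = c x"
    using x irr symD unfolding U_def W_def by auto
  have d: "distinct [v, u, x, w]"
    using x(2) xw vu vw irr by auto
  let ?F = "switch_arcs E v u x w"
  have "colour_switch c E ?F"
    unfolding colour_switch_def using d vu xw vw(1) ux c cx by blast
  moreover have "?F `` {v} = insert w (E `` {v} - {u})"
    by (simp add: switch_arcs_nbrs[OF E d])
  moreover have "?F `` {z} = E `` {z}" if "z \<notin> T" for z
    using that T xT by (auto simp: switch_arcs_nbrs[OF E d])
  ultimately show thesis by (rule that)
qed

text \<open>The colour of \<open>u\<close> occurs equally often in \<open>A\<close> and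
  \<open>B\<close>; without \<open>w\<close>, its class in \<open>B\<close> would be a proper subset
  of that in \<open>A\<close>.\<close>

lemma ex_same_colour_Diff:
  assumes "finite A" "finite B"
    and eq: "image_mset c (mset_set A) = image_mset c (mset_set B)"
    and u: "u \<in> A" "u \<notin> B"
  obtains w where "w \<in> B" "w \<notin> A" "c w = c u"
proof (rule ccontr)
  assume neg: "\<not> thesis"
  have "card (c -` {c u} \<inter> A) = card (c -` {c u} \<inter> B)"
    using arg_cong[OF eq, of "\<lambda>M. count M (c u)"] assms(1,2)
    by (simp add: count_image_mset)
  moreover have "c -` {c u} \<inter> B \<subset> c -` {c u} \<inter> A"
    using neg that u by auto
  then have "card (c -` {c u} \<inter> B) < card (c -` {c u} \<inter> A)"
    using assms(1) by (intro psubset_card_mono) auto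
  ultimately show False by simp
qed

definition agree_off :: "'a set \<Rightarrow> 'a rel \<Rightarrow> 'a rel \<Rightarrow> bool" where
  "agree_off T E F \<longleftrightarrow> (\<forall>z. z \<notin> T \<longrightarrow> E `` {z} = F `` {z})"

lemma agree_off_nbr_iff:
  assumes "agree_off T E F" "simple_arcs E" "simple_arcs F" "u \<notin> T"
  shows "(v, u) \<in> E \<longleftrightarrow> (v, u) \<in> F"
  using assms simple_arcs_symD unfolding agree_off_def by fast

text \<open>Neighbours outside \<open>T\<close> are common to both graphs and cancel from the equal
  total counts.\<close>

lemma agree_off_card_eq:
  assumes "agree_off T E F" and E: "simple_arcs E" and F: "simple_arcs F"
    and eq: "nbr_colours c E z = nbr_colours c F z"
  shows "card {x \<in> E `` {z} \<inter> T. c x = k} = card {x \<in> F `` {z} \<inter> T. c x = k}"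
proof -
  have split: "card {x \<in> D `` {z}. c x = k} =
      card {x \<in> D `` {z} \<inter> T. c x = k} + card {x \<in> D `` {z} - T. c x = k}"
    if "simple_arcs D" for D
  proof -
    have "{x \<in> D `` {z}. c x = k} =
        {x \<in> D `` {z} \<inter> T. c x = k} \<union> {x \<in> D `` {z} - T. c x = k}" by blast
    moreover have "finite {x \<in> D `` {z} \<inter> T. c x = k}" "finite {x \<in> D `` {z} - T. c x = k}"
      using finite_nbrs[OF that, of z] by (simp_all del: Image_singleton_iff)
    ultimately show ?thesis by (simp add: card_Un_disjoint disjoint_iff)
  qed
  have rest: "{x \<in> E `` {z} - T. c x = k} = {x \<in> F `` {z} - T. c x = k}"
    using agree_off_nbr_iff[OF assms(1-3)] by auto
  show ?thesis
    using split[OF E] split[OF F] arg_cong[OF eq, of "\<lambda>M. count M k"]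
    unfolding count_nbr_colours[OF E] count_nbr_colours[OF F] rest by linarith
qed

text \<open>Induction on the number of neighbours that \<open>v\<close> has in \<open>E\<close>
  only; a switch in either graph lowers it.\<close>

lemma align_nbrs:
  assumes "simple_arcs E" "simple_arcs F" "agree_off T E F" "v \<in> T"
    and "\<And>z. nbr_colours c E z = nbr_colours c F z"
  shows "\<exists>E' F'. (colour_switch c)\<^sup>*\<^sup>* E E' \<and> (colour_switch c)\<^sup>*\<^sup>* F F' \<and>
    agree_off T E' F' \<and> E' `` {v} = F' `` {v}"
  using assms
proof (induction "card (E `` {v} - F `` {v})" arbitrary: E F rule: less_induct)
  case less
  note E = less.prems(1) and F = less.prems(2) and ag = less.prems(3) and eq = less.prems(5)
  have finE: "finite (E `` {v})" and finF: "finite (F `` {v})"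
    using E F by (simp_all add: finite_nbrs)
  show ?case
  proof (cases "E `` {v} = F `` {v}")
    case True
    then show ?thesis using ag by blast
  next
    case False
    \<comment> \<open>If the neighbourhoods differ by a vertex in \<open>F\<close> only, equal
      colour counts also give one in \<open>E\<close> only.\<close>
    then obtain u where u: "u \<in> E `` {v}" "u \<notin> F `` {v}"
      using ex_same_colour_Diff[OF finF finE] eq[of v] unfolding nbr_colours_def
      by (metis subsetI subset_antisym)
    obtain w where w: "w \<in> F `` {v}" "w \<notin> E `` {v}" "c w = c u"
      using ex_same_colour_Diff[OF finE finF _ u] eq[of v] unfolding nbr_colours_def by metis
    have T: "u \<in> T" "w \<in> T"
      using agree_off_nbr_iff[OF ag E F] u w by auto
    have ne: "v \<noteq> u" "v \<noteq> w"
      using u w simple_arcs_irreflD[OF E] simple_arcs_irreflD[OF F] by auto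
    note cardeq = agree_off_card_eq[OF ag E F eq]
    have fin: "finite (E `` {v} - F `` {v})" using finE by simp
    show ?thesis
    proof (cases "card {x \<in> E `` {u} \<inter> T. c x = c v} \<le> card {x \<in> E `` {w} \<inter> T. c x = c v}")
      case True
      obtain E1 where E1: "colour_switch c E E1" "E1 `` {v} = insert w (E `` {v} - {u})"
        "\<And>z. z \<notin> T \<Longrightarrow> E1 `` {z} = E `` {z}"
        using exchange_nbr[OF E \<open>v \<in> T\<close> T _ _ ne(2) _ True] u w by auto
      \<comment> \<open>\<open>u\<close> leaves the difference, and \<open>w\<close> does not enter
        it, being a neighbour of \<open>v\<close> in \<open>F\<close>.\<close>
      have "E1 `` {v} - F `` {v} \<subset> E `` {v} - F `` {v}"
        using E1(2) u w by auto
      then have "card (E1 `` {v} - F `` {v}) < card (E `` {v} - F `` {v})"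
        using fin by (rule psubset_card_mono[rotated])
      moreover have "simple_arcs E1" using E1(1) E by (rule colour_switch_simple)
      moreover have "agree_off T E1 F" using ag E1(3) by (auto simp: agree_off_def)
      moreover have "nbr_colours c E1 z = nbr_colours c F z" for z
        using colour_switch_nbr_colours[OF E1(1) E] eq by simp
      ultimately obtain E' F' where "(colour_switch c)\<^sup>*\<^sup>* E1 E'" "(colour_switch c)\<^sup>*\<^sup>* F F'"
        "agree_off T E' F'" "E' `` {v} = F' `` {v}"
        using less.hyps[of E1 F] F \<open>v \<in> T\<close> by blast
      then show ?thesis
        using E1(1) by (meson converse_rtranclp_into_rtranclp)
    next
      case False
      \<comment> \<open>Counts inside \<open>T\<close> agree in both graphs, so the failed
        inequality gives the reverse one in \<open>F\<close>, with \<open>u\<close> and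
        \<open>w\<close> interchanged.\<close>
      then have le: "card {x \<in> F `` {w} \<inter> T. c x = c v} \<le> card {x \<in> F `` {u} \<inter> T. c x = c v}"
        using cardeq by simp
      obtain F1 where F1: "colour_switch c F F1" "F1 `` {v} = insert u (F `` {v} - {w})"
        "\<And>z. z \<notin> T \<Longrightarrow> F1 `` {z} = F `` {z}"
        using exchange_nbr[OF F \<open>v \<in> T\<close> T(2,1) _ _ ne(1) _ le] u w by auto
      have "E `` {v} - F1 `` {v} \<subset> E `` {v} - F `` {v}"
        using F1(2) u w by auto
      then have "card (E `` {v} - F1 `` {v}) < card (E `` {v} - F `` {v})"
        using fin by (rule psubset_card_mono[rotated])
      moreover have "simple_arcs F1" using F1(1) F by (rule colour_switch_simple)
      moreover have "agree_off T E F1" using ag F1(3) by (auto simp: agree_off_def)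
      moreover have "nbr_colours c E z = nbr_colours c F1 z" for z
        using colour_switch_nbr_colours[OF F1(1) F] eq by simp
      ultimately obtain E' F' where "(colour_switch c)\<^sup>*\<^sup>* E E'" "(colour_switch c)\<^sup>*\<^sup>* F1 F'"
        "agree_off T E' F'" "E' `` {v} = F' `` {v}"
        using less.hyps[of E F1] E \<open>v \<in> T\<close> by blast
      then show ?thesis
        using F1(1) by (meson converse_rtranclp_into_rtranclp)
    qed
  qed
qed

text \<open>Aligning one vertex moves it out of \<open>T\<close>. The path runs from
  \<open>E\<close> to \<open>E'\<close>, by induction to \<open>F'\<close>, and back along the
  reversed switches to \<open>F\<close>.\<close>

lemma colour_switches_if_agree_off:
  assumes "finite T" "simple_arcs E" "simple_arcs F" "agree_off T E F"
    and "\<And>z. nbr_colours c E z = nbr_colours c F z"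
  shows "(colour_switch c)\<^sup>*\<^sup>* E F"
  using assms
proof (induction T arbitrary: E F rule: finite_induct)
  case empty
  then have "E = F" unfolding agree_off_def by auto
  then show ?case by simp
next
  case (insert v T)
  note E = insert.prems(1) and F = insert.prems(2)
  obtain E' F' where EE': "(colour_switch c)\<^sup>*\<^sup>* E E'" and FF': "(colour_switch c)\<^sup>*\<^sup>* F F'"
    and "agree_off (insert v T) E' F'" "E' `` {v} = F' `` {v}"
    using align_nbrs[OF insert.prems(1-3) insertI1 insert.prems(4)] by blast
  then have "agree_off T E' F'" by (auto simp: agree_off_def)
  moreover have "nbr_colours c E' z = nbr_colours c F' z" for z
    using colour_switches_invariants[OF EE' E] colour_switches_invariants[OF FF' F]
      insert.prems(4) by metis
  ultimately have "(colour_switch c)\<^sup>*\<^sup>* E' F'"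
    using insert.IH colour_switches_invariants[OF EE' E] colour_switches_invariants[OF FF' F]
    by blast
  then show ?case
    using EE' colour_switches_sym[OF FF' F] by (meson rtranclp_trans)
qed

theorem colour_switches_iff:
  assumes E: "simple_arcs E" and F: "simple_arcs F"
  shows "(colour_switch c)\<^sup>*\<^sup>* E F \<longleftrightarrow> (\<forall>v. nbr_colours c E v = nbr_colours c F v)"
proof
  assume "\<forall>v. nbr_colours c E v = nbr_colours c F v"
  \<comment> \<open>Outside both fields all neighbourhoods are empty, so this union can serve as the
    initial \<open>T\<close>.\<close>
  moreover have "agree_off (Field E \<union> Field F) E F"
    by (auto simp: agree_off_def Field_def)
  moreover have "finite (Field E \<union> Field F)"
    using E F by (simp add: simple_arcs_def finite_Field)
  ultimately show "(colour_switch c)\<^sup>*\<^sup>* E F"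
    using colour_switches_if_agree_off E F by blast
qed (use colour_switches_invariants E in metis)

section \<open>Degree restricted switches\<close>

lemma simple_arcs_pair_graph:
  assumes "pair_graph G"
  shows "simple_arcs (parcs G)"
proof -
  interpret pair_graph G by fact
  show ?thesis
    unfolding simple_arcs_def irrefl_def
    using pair_sym_arcs pair_no_loops pair_finite_arcs by (fastforce simp: symmetric_def)
qed

lemma vertex_degree_conv: "vertex_degree G v = card (parcs G `` {v})"
proof -
  have "out_arcs (with_proj G) v = Pair v ` (parcs G `` {v})"
    by (auto simp: out_arcs_def)
  then show ?thesis
    unfolding vertex_degree_def out_degree_def by (simp add: card_image inj_on_def)
qed

text \<open>Degrees can be read off neighbour colours for any colouring, so colour switches preserve
  degrees.\<close>

lemma size_nbr_colours: "size (nbr_colours c (parcs G) v) = vertex_degree G v"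
  by (simp add: nbr_colours_def vertex_degree_conv)

lemma two_switch_iff:
  "two_switch G a b x y H \<longleftrightarrow> distinct [a, b, x, y] \<and> (a, b) \<in> parcs G \<and> (x, y) \<in> parcs G \<and>
     (a, y) \<notin> parcs G \<and> (b, x) \<notin> parcs G \<and>
     parcs H = switch_arcs (parcs G) a b x y \<and> pverts G = pverts H"
proof -
  have "H = G\<lparr>parcs := F\<rparr> \<longleftrightarrow> parcs H = F \<and> pverts G = pverts H" for F
    by (cases G, cases H) auto
  then show ?thesis
    unfolding two_switch_def switch_arcs_def by (simp only:)
qed

lemma degree_restricted_two_switch_iff:
  "degree_restricted_two_switch G H \<longleftrightarrow>
     colour_switch (vertex_degree G) (parcs G) (parcs H) \<and> pverts G = pverts H"
  unfolding degree_restricted_two_switch_def two_switch_iff colour_switch_def by blast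

text \<open>Degrees never change along the sequence, so the degrees in \<open>G\<close> can serve as
  one fixed colouring.\<close>

lemma degree_restricted_switches_iff:
  assumes G: "pair_graph G" and V: "pverts G = pverts H"
  shows "degree_restricted_two_switch\<^sup>*\<^sup>* G H \<longleftrightarrow>
    (colour_switch (vertex_degree G))\<^sup>*\<^sup>* (parcs G) (parcs H)" (is "?l \<longleftrightarrow> ?r")
proof
  note sG = simple_arcs_pair_graph[OF G]
  have deg: "vertex_degree K = vertex_degree G"
    if "(colour_switch (vertex_degree G))\<^sup>*\<^sup>* (parcs G) (parcs K)" for K
    using colour_switches_invariants[OF that sG] by (metis ext size_nbr_colours)
  show ?r if ?l
    using that
  proof induction
    case (step K L)
    then show ?case
      using deg[of K] by (auto simp: degree_restricted_two_switch_iff)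
  qed simp
  \<comment> \<open>Each intermediate arc set becomes a graph on the vertices of
    \<open>G\<close>.\<close>
  have "degree_restricted_two_switch\<^sup>*\<^sup>* G (G\<lparr>parcs := F\<rparr>)"
    if "(colour_switch (vertex_degree G))\<^sup>*\<^sup>* (parcs G) F" for F
    using that
  proof induction
    case (step E F)
    have "colour_switch (vertex_degree (G\<lparr>parcs := E\<rparr>)) E F"
      using step deg[of "G\<lparr>parcs := E\<rparr>"] by simp
    then have "degree_restricted_two_switch (G\<lparr>parcs := E\<rparr>) (G\<lparr>parcs := F\<rparr>)"
      by (simp add: degree_restricted_two_switch_iff)
    then show ?case using step.IH by simp
  qed simp
  moreover have "G\<lparr>parcs := parcs H\<rparr> = H"
    using V by (cases G, cases H) auto
  ultimately show ?l if ?r using that by metis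
qed

section \<open>Graphs of diameter 2\<close>

text \<open>Walks of length at most 1 reach only \<open>v\<close> and its neighbours; the diameter
  bounds all other distances by 2.\<close>

lemma N2_diameter_2:
  assumes G: "pair_graph G" and diam: "graph_diameter G = 2" and v: "v \<in> pverts G"
  shows "N2 G v = pverts G - insert v (parcs G `` {v})"
proof -
  interpret pair_graph G by fact
  have dist: "distance G v u = \<mu> (\<lambda>_. 1) v u" for u
    by (simp add: distance_def)
  have len: "awalk_cost (\<lambda>_. 1) p = length p" for p :: "('a \<times> 'a) list"
    by (induction p) auto
  have upper: "distance G v u \<le> length p" if "awalk v p u" for u p
    using min_cost_le_walk_cost[OF that, of "\<lambda>_. 1"] by (simp add: dist len)
  have "distance G v u = 2 \<longleftrightarrow> u \<noteq> v \<and> (v, u) \<notin> parcs G" if u: "u \<in> pverts G" for u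
  proof
    assume two: "distance G v u = 2"
    have "\<not> awalk v p u" if "length p \<le> 1" for p
    proof
      assume "awalk v p u"
      from upper[OF this] two have "(2 :: ereal) \<le> ereal (length p)" by simp
      then have "2 \<le> length p" by simp
      with that show False by simp
    qed
    from this[of "[]"] this[of "[(v, u)]"] v u show "u \<noteq> v \<and> (v, u) \<notin> parcs G"
      by (auto simp: awalk_simps)
  next
    assume *: "u \<noteq> v \<and> (v, u) \<notin> parcs G"
    have "2 \<le> length p" if "awalk v p u" for p
    proof (rule ccontr)
      assume "\<not> 2 \<le> length p"
      then consider "p = []" | e where "p = [e]"
        by (metis One_nat_def Suc_leI Suc_1 length_0_conv length_Suc_conv less_Suc_eq not_le less_one)
      then show False using that * by cases (auto simp: awalk_simps)
    qed
    then have "2 \<le> distance G v u"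
      unfolding dist \<mu>_def by (intro INF_greatest) (auto simp: len)
    moreover have "distance G v u \<le> 2"
      unfolding diam[symmetric] graph_diameter_def
      using v u by (intro SUP_upper2[of "(v, u)"]) auto
    ultimately show "distance G v u = 2" by simp
  qed
  then show ?thesis unfolding N2_def by auto
qed

lemma mset_N2DL: "mset (N2DL G v) = image_mset (vertex_degree G) (mset_set (N2 G v))"
  by (simp add: N2DL_def)

text \<open>Being sorted, each list is determined by its multiset.\<close>

lemma N2DL_eq_iff:
  "N2DL G v = N2DL H v \<longleftrightarrow>
     image_mset (vertex_degree G) (mset_set (N2 G v)) =
     image_mset (vertex_degree H) (mset_set (N2 H v))"
  by (metis N2DL_def mset_N2DL)

text \<open>The vertices split into \<open>v\<close>, its neighbours and \<open>N2 G v\<close>, so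
  either colour multiset determines the other.\<close>

lemma nbr_colours_plus_N2:
  assumes G: "pair_graph G" and diam: "graph_diameter G = 2" and v: "v \<in> pverts G"
  shows "nbr_colours c (parcs G) v + add_mset (c v) (image_mset c (mset_set (N2 G v))) =
    image_mset c (mset_set (pverts G))"
proof -
  interpret pair_graph G by fact
  note s = simple_arcs_pair_graph[OF G]
  let ?N = "parcs G `` {v}"
  have "pverts G = ?N \<union> insert v (N2 G v)"
    using v in_arcsD2 by (auto simp: N2_diameter_2[OF assms])
  moreover have "?N \<inter> insert v (N2 G v) = {}" "v \<notin> N2 G v"
    using simple_arcs_irreflD[OF s] by (auto simp: N2_diameter_2[OF assms])
  moreover have "finite ?N" "finite (N2 G v)"
    using finite_nbrs[OF s] pair_finite_verts by (auto simp: N2_def)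
  ultimately have "mset_set (pverts G) = mset_set ?N + add_mset v (mset_set (N2 G v))"
    by (metis finite_insert mset_set.insert mset_set_Union)
  then show ?thesis by (simp add: nbr_colours_def)
qed

theorem theorem1p1:
  fixes G H :: "'a pair_pre_digraph" and vs :: "'a list" and n :: nat
  assumes "pair_graph G" and "pair_graph H"
    and "distinct vs" and "length vs = n"
    and "pverts G = set vs" and "pverts H = set vs"
    and "graph_diameter G = 2" and "graph_diameter H = 2"
  shows "N2DL_graph G vs = N2DL_graph H vs \<longleftrightarrow> degree_restricted_two_switch\<^sup>*\<^sup>* G H"
proof -
  let ?c = "vertex_degree G"
  note G = nbr_colours_plus_N2[OF assms(1,7)] and H = nbr_colours_plus_N2[OF assms(2,8)]
  \<comment> \<open>This extends equalities on \<open>vs\<close> to equalities of functions on the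
    whole type.\<close>
  have outside: "vertex_degree K v = 0 \<and> nbr_colours c (parcs K) v = {#}"
    if "pair_graph K" "v \<notin> pverts K" for K :: "'a pair_pre_digraph" and v c
  proof -
    interpret pair_graph K by fact
    have "parcs K `` {v} = {}" using that(2) in_arcsD1 by blast
    then show ?thesis by (simp add: vertex_degree_conv nbr_colours_def)
  qed
  \<comment> \<open>\<open>N2DL H\<close> uses degrees in \<open>H\<close> but the colouring uses
    those in \<open>G\<close>, hence the premise that they agree.\<close>
  have key: "N2DL G v = N2DL H v \<longleftrightarrow>
      nbr_colours ?c (parcs G) v = nbr_colours ?c (parcs H) v"
    if "vertex_degree G = vertex_degree H" "v \<in> set vs" for v
  proof -
    have cancel: "b = b' \<longleftrightarrow> a = a'" if "a + add_mset k b = a' + add_mset k b'"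
      for a a' b b' :: "nat multiset" and k
      using that by auto
    have "nbr_colours ?c (parcs G) v + add_mset (?c v) (image_mset ?c (mset_set (N2 G v))) =
        nbr_colours ?c (parcs H) v + add_mset (?c v) (image_mset ?c (mset_set (N2 H v)))"
      using G[of v ?c] H[of v ?c] that(2) assms(5,6) by simp
    from cancel[OF this] show ?thesis
      unfolding N2DL_eq_iff that(1) .
  qed
  \<comment> \<open>The length of the list at \<open>v\<close> is the size of \<open>N2\<close>, and
    the degree of \<open>v\<close> is the number of vertices minus 1 minus that size.\<close>
  have deg_N2DL: "vertex_degree G = vertex_degree H" if eq: "\<forall>v \<in> set vs. N2DL G v = N2DL H v"
  proof
    fix v
    show "vertex_degree G v = vertex_degree H v"
    proof (cases "v \<in> set vs")
      case True
      have "size (mset (N2DL G v)) = size (mset (N2DL H v))" using eq True by simp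
      then have "card (N2 G v) = card (N2 H v)" by (simp only: mset_N2DL) simp
      moreover have "vertex_degree G v + Suc (card (N2 G v)) = card (set vs)"
        using arg_cong[OF G[of v ?c], of size] True assms(5)
        by (simp add: size_nbr_colours)
      moreover have "vertex_degree H v + Suc (card (N2 H v)) = card (set vs)"
        using arg_cong[OF H[of v ?c], of size] True assms(6)
        by (simp add: size_nbr_colours)
      ultimately show ?thesis by simp
    next
      case False
      then show ?thesis using outside assms(1,2,5,6) by metis
    qed
  qed
  have deg_colours: "vertex_degree G = vertex_degree H"
    if "\<forall>v. nbr_colours ?c (parcs G) v = nbr_colours ?c (parcs H) v"
    using that by (metis ext size_nbr_colours)
  have "N2DL_graph G vs = N2DL_graph H vs \<longleftrightarrow> (\<forall>v \<in> set vs. N2DL G v = N2DL H v)"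
    by (simp add: N2DL_graph_def)
  \<comment> \<open>Either side forces equal degrees, which is what \<open>key\<close>
    requires.\<close>
  also have "\<dots> \<longleftrightarrow> (\<forall>v. nbr_colours ?c (parcs G) v = nbr_colours ?c (parcs H) v)"
    using key deg_N2DL deg_colours outside assms(1,2,5,6) by metis
  also have "\<dots> \<longleftrightarrow> degree_restricted_two_switch\<^sup>*\<^sup>* G H"
    using assms(1,2,5,6)
    by (simp add: degree_restricted_switches_iff colour_switches_iff simple_arcs_pair_graph)
  finally show ?thesis .
qed

end
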